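(* Let $G$ be a pseudo-bipartite graph on $2m$ vertices with clusters $C_1=\{v_{1,1},\dots,v_{1,m}\}$ and $C_2=\{v_{2,1},\dots,v_{2,m}\}$. Then $G$ and its graph theoretical partial transpose $G^\tau$ are isomorphic, and hence cospectral. In particular, if $G$ is a bipartite graph whose two parts have the same number $m$ of vertices, taken as the two clusters $C_1,C_2$, then $G$ and $G^\tau$ are isomorphic.
   Context: All graphs are finite, simple and undirected. A clustered graph on $mn$ vertices with clusters $C_i=\{v_{i,1},\dots,v_{i,m}\}$, $i=1,\dots,n$, is a graph whose labelled vertex set is partitioned into these clusters; $C_i$ also denotes the subgraph induced by its vertices. The graph theoretical partial transpose (GTPT) $G^\tau$ of such a graph is the graph on the same vertex set obtained from $G$ as follows: every edge inside a cluster and every edge of the form $(v_{i,k},v_{j,k})$ is kept, and every edge $(v_{i,k},v_{j,l})$ with $i\neq j$ and $k\neq l$ is removed and replaced by the edge $(v_{i,l},v_{j,k})$. Equivalently, if the adjacency matrix of $G$ is the block matrix $[A_{i,j}]_{i,j=1}^n$ with $m\times m$ blocks, where $(A_{i,j})_{\alpha\beta}=1$ iff $v_{i,\alpha}$ and $v_{j,\beta}$ are adjacent, then the adjacency matrix of $G^\tau$ is $[A_{i,j}^t]$. A clustered graph with two clusters $C_1,C_2$ of $m$ vertices each is called pseudo-bipartite if the map $v_{1,j}\mapsto v_{2,j}$ ($j=1,\dots,m$) is an isomorphism from the induced subgraph on $C_1$ to the induced subgraph on $C_2$. Two graphs are cospectral if their adjacency matrices have the same multiset of eigenvalues. *)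

theory Defs
  imports
    "Graph_Theory.Pair_Digraph"
    "Graph_Theory.Digraph_Isomorphism"
    "Jordan_Normal_Form.Char_Poly"
    "HOL-Computational_Algebra.Polynomial"
begin

text \<open>
  A finite simple undirected graph is a \<open>pair_graph\<close>: an undirected edge \<open>{x, y}\<close> is
  represented by the two arcs \<open>(x, y)\<close> and \<open>(y, x)\<close>.  The labelling \<open>v i k\<close>
  (\<open>1 \<le> i \<le> n\<close>, \<open>1 \<le> k \<le> m\<close>) enumerates the vertices without repetition, so that
  the clusters below partition the vertex set into \<open>n\<close> sets of size \<open>m\<close>.
\<close>

locale clustered_graph = pair_graph G
  for G :: "'a pair_pre_digraph" +
  fixes n m :: nat and v :: "nat \<Rightarrow> nat \<Rightarrow> 'a"
  assumes labelling: "bij_betw (\<lambda>(i, k). v i k) ({1..n} \<times> {1..m}) (pverts G)"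

definition cluster :: "nat \<Rightarrow> (nat \<Rightarrow> nat \<Rightarrow> 'a) \<Rightarrow> nat \<Rightarrow> 'a set" where
  "cluster m v i = v i ` {1..m}"

definition gtpt ::
  "'a pair_pre_digraph \<Rightarrow> nat \<Rightarrow> nat \<Rightarrow> (nat \<Rightarrow> nat \<Rightarrow> 'a) \<Rightarrow> 'a pair_pre_digraph" where
  "gtpt G n m v = \<lparr> pverts = pverts G,
     parcs =
       (parcs G - {(v i k, v j l) | i j k l.
          i \<in> {1..n} \<and> j \<in> {1..n} \<and> k \<in> {1..m} \<and> l \<in> {1..m} \<and> i \<noteq> j \<and> k \<noteq> l})
       \<union> {(v i l, v j k) | i j k l.
          i \<in> {1..n} \<and> j \<in> {1..n} \<and> k \<in> {1..m} \<and> l \<in> {1..m} \<and> i \<noteq> j \<and> k \<noteq> l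
          \<and> (v i k, v j l) \<in> parcs G} \<rparr>"

text \<open>
  The map \<open>v 1 k \<mapsto> v 2 k\<close> is the vertex part of the isomorphism \<open>f\<close>; the arc part is
  determined by it, since tails and heads on both sides are \<open>fst\<close> and \<open>snd\<close>.
\<close>

definition pseudo_bipartite ::
  "'a pair_pre_digraph \<Rightarrow> nat \<Rightarrow> (nat \<Rightarrow> nat \<Rightarrow> 'a) \<Rightarrow> bool" where
  "pseudo_bipartite G m v \<longleftrightarrow> clustered_graph G 2 m v \<and>
     (\<exists>f. pre_digraph.digraph_isomorphism (with_proj G \<restriction> cluster m v 1) f \<and>
          (\<forall>k \<in> {1..m}. iso_verts f (v 1 k) = v 2 k) \<and>
          with_proj G \<restriction> cluster m v 2 = app_iso f (with_proj G \<restriction> cluster m v 1))"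

definition bipartition :: "'a pair_pre_digraph \<Rightarrow> 'a set \<Rightarrow> 'a set \<Rightarrow> bool" where
  "bipartition G X Y \<longleftrightarrow> X \<union> Y = pverts G \<and> X \<inter> Y = {} \<and>
     (\<forall>(x, y) \<in> parcs G. (x \<in> X \<and> y \<in> Y) \<or> (x \<in> Y \<and> y \<in> X))"

definition adjacency_mat :: "'a pair_pre_digraph \<Rightarrow> 'a list \<Rightarrow> complex mat" where
  "adjacency_mat G vs = mat (length vs) (length vs)
     (\<lambda>(i, j). if (vs ! i, vs ! j) \<in> parcs G then 1 else 0)"

text \<open>
  The multiset of eigenvalues is taken with algebraic multiplicities.  It does not depend on the
  order in which the vertices are enumerated; the definition demands equality for all
  enumerations (which exist, as vertex sets are finite).
\<close>

definition cospectral :: "'a pair_pre_digraph \<Rightarrow> 'b pair_pre_digraph \<Rightarrow> bool" where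
  "cospectral G H \<longleftrightarrow>
     (\<forall>vs ws. distinct vs \<and> set vs = pverts G \<and> distinct ws \<and> set ws = pverts H \<longrightarrow>
        proots (char_poly (adjacency_mat G vs)) = proots (char_poly (adjacency_mat H ws)))"

lemma (in clustered_graph) label_eq_iff:
  assumes "i \<in> {1..n}" "j \<in> {1..n}" "k \<in> {1..m}" "l \<in> {1..m}"
  shows "v i k = v j l \<longleftrightarrow> i = j \<and> k = l"
  using inj_on_eq_iff[OF bij_betw_imp_inj_on[OF labelling], of "(i, k)" "(j, l)"] assms by simp

lemma (in clustered_graph) arc_sym: "(x, y) \<in> parcs G \<Longrightarrow> (y, x) \<in> parcs G"
  using pair_sym_arcs by (auto simp: symmetric_def dest: symD)

text \<open>The blocks of the adjacency matrix are transposed.\<close>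

lemma (in clustered_graph) gtpt_arc_iff:
  assumes "i \<in> {1..n}" "j \<in> {1..n}" "k \<in> {1..m}" "l \<in> {1..m}"
  shows "(v i k, v j l) \<in> parcs (gtpt G n m v) \<longleftrightarrow> (v i l, v j k) \<in> parcs G"
proof -
  define A where "A = {(v i k, v j l) | i j k l.
          i \<in> {1..n} \<and> j \<in> {1..n} \<and> k \<in> {1..m} \<and> l \<in> {1..m} \<and> i \<noteq> j \<and> k \<noteq> l}"
  define B where "B = {(v i l, v j k) | i j k l.
          i \<in> {1..n} \<and> j \<in> {1..n} \<and> k \<in> {1..m} \<and> l \<in> {1..m} \<and> i \<noteq> j \<and> k \<noteq> l
          \<and> (v i k, v j l) \<in> parcs G}"
  have G: "parcs (gtpt G n m v) = (parcs G - A) \<union> B"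
    by (simp only: gtpt_def A_def B_def pair_pre_digraph.simps)
  have A: "(v i k, v j l) \<in> A \<longleftrightarrow> i \<noteq> j \<and> k \<noteq> l"
  proof
    assume "(v i k, v j l) \<in> A"
    then obtain i' j' k' l' where *: "v i k = v i' k'" "v j l = v j' l'" "i' \<in> {1..n}"
      "j' \<in> {1..n}" "k' \<in> {1..m}" "l' \<in> {1..m}" "i' \<noteq> j'" "k' \<noteq> l'"
      unfolding A_def by blast
    have "i = i' \<and> k = k'" "j = j' \<and> l = l'"
      using label_eq_iff[of i i' k k'] label_eq_iff[of j j' l l'] assms * by simp_all
    with * show "i \<noteq> j \<and> k \<noteq> l" by simp
  next
    assume "i \<noteq> j \<and> k \<noteq> l"
    with assms show "(v i k, v j l) \<in> A" unfolding A_def by blast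
  qed
  have B: "(v i k, v j l) \<in> B \<longleftrightarrow> i \<noteq> j \<and> k \<noteq> l \<and> (v i l, v j k) \<in> parcs G"
  proof
    assume "(v i k, v j l) \<in> B"
    then obtain i' j' k' l' where *: "v i k = v i' l'" "v j l = v j' k'" "i' \<in> {1..n}"
      "j' \<in> {1..n}" "k' \<in> {1..m}" "l' \<in> {1..m}" "i' \<noteq> j'" "k' \<noteq> l'"
      "(v i' k', v j' l') \<in> parcs G"
      unfolding B_def by blast
    have "i = i' \<and> k = l'" "j = j' \<and> l = k'"
      using label_eq_iff[of i i' k l'] label_eq_iff[of j j' l k'] assms * by simp_all
    with * show "i \<noteq> j \<and> k \<noteq> l \<and> (v i l, v j k) \<in> parcs G" by simp
  next
    assume *: "i \<noteq> j \<and> k \<noteq> l \<and> (v i l, v j k) \<in> parcs G"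
    show "(v i k, v j l) \<in> B"
      unfolding B_def mem_Collect_eq
      by (rule exI[of _ i], rule exI[of _ j], rule exI[of _ l], rule exI[of _ k])
        (use * assms in simp)
  qed
  show ?thesis
  proof (cases "i \<noteq> j \<and> k \<noteq> l")
    case True
    then show ?thesis unfolding G Un_iff Diff_iff using A B by blast
  next
    case False
    then have "(v i k, v j l) \<in> parcs G \<longleftrightarrow> (v i l, v j k) \<in> parcs G"
      using arc_sym by auto
    then show ?thesis unfolding G Un_iff Diff_iff using A B False by blast
  qed
qed

lemma (in clustered_graph) vertex_cases:
  assumes "x \<in> pverts G"
  obtains i k where "x = v i k" "i \<in> {1..n}" "k \<in> {1..m}"
  using bij_betw_imp_surj_on[OF labelling] assms by fastforce

lemma (in clustered_graph) label_in_verts: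
  "i \<in> {1..n} \<Longrightarrow> k \<in> {1..m} \<Longrightarrow> v i k \<in> pverts G"
  using bij_betw_imp_surj_on[OF labelling] by fastforce

lemma (in clustered_graph) gtpt_arcs_in_verts:
  "(x, y) \<in> parcs (gtpt G n m v) \<Longrightarrow> x \<in> pverts G \<and> y \<in> pverts G"
  using in_arcsD1 in_arcsD2 label_in_verts unfolding gtpt_def by auto

lemma (in clustered_graph) gtpt_clustered_graph: "clustered_graph (gtpt G n m v) n m v"
proof
  have V: "pverts (gtpt G n m v) = pverts G"
    by (simp add: gtpt_def)
  show "fst e \<in> pverts (gtpt G n m v)" "snd e \<in> pverts (gtpt G n m v)"
    if "e \<in> parcs (gtpt G n m v)" for e
    using gtpt_arcs_in_verts[of "fst e" "snd e"] that V by auto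
  show "finite (pverts (gtpt G n m v))"
    using V pair_finite_verts by simp
  have "parcs (gtpt G n m v) \<subseteq> pverts G \<times> pverts G"
    using gtpt_arcs_in_verts by auto
  then show "finite (parcs (gtpt G n m v))"
    using pair_finite_verts by (meson finite_SigmaI finite_subset)
  show "fst e \<noteq> snd e" if e: "e \<in> parcs (gtpt G n m v)" for e
  proof
    assume eq: "fst e = snd e"
    have "fst e \<in> pverts G" using gtpt_arcs_in_verts[of "fst e" "snd e"] e by simp
    then obtain i k where ik: "fst e = v i k" "i \<in> {1..n}" "k \<in> {1..m}" by (rule vertex_cases)
    then have "(v i k, v i k) \<in> parcs G"
      using gtpt_arc_iff[of i i k k] e eq by (metis prod.collapse)
    then show False using pair_no_loops by fastforce
  qed
  have "(y, x) \<in> parcs (gtpt G n m v)" if xy: "(x, y) \<in> parcs (gtpt G n m v)" for x y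
  proof -
    have "x \<in> pverts G" "y \<in> pverts G" using gtpt_arcs_in_verts[OF xy] by auto
    then obtain i k j l where "x = v i k" "i \<in> {1..n}" "k \<in> {1..m}"
      "y = v j l" "j \<in> {1..n}" "l \<in> {1..m}" by (metis vertex_cases)
    with xy show ?thesis using gtpt_arc_iff arc_sym by simp
  qed
  then show "symmetric (with_proj (gtpt G n m v))"
    by (auto simp: symmetric_def intro!: symI)
  show "bij_betw (\<lambda>(i, k). v i k) ({1..n} \<times> {1..m}) (pverts (gtpt G n m v))"
    using labelling V by simp
qed

end

theory Submission
  imports Defs "HOL-Combinatorics.List_Permutation"
begin

text \<open>
  Swapping the clusters, \<open>v 1 k \<leftrightarrow> v 2 k\<close>, is an isomorphism from \<open>G\<close> to its partial transpose.
  On arcs between the clusters it does exactly what the partial transpose does, up to reversing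
  the arc; on arcs inside a cluster it is compatible with \<open>G\<close> because the clusters carry
  the same graph (which is edgeless in the bipartite case).
\<close>

text \<open>Permuting the rows contributes a factor \<open>signof p\<close>. Permuting the columns
  is permuting the rows of the transpose and contributes the same factor, so the signs
  cancel.\<close>

lemma det_permute_both:
  assumes A: "A \<in> carrier_mat n n" and p: "p permutes {0..<n}"
  shows "det (mat n n (\<lambda>(i, j). A $$ (p i, p j))) = (det A :: 'a :: comm_ring_1)"
proof -
  define B where "B = mat n n (\<lambda>(i, j). A $$ (p i, j))"
  have B: "B \<in> carrier_mat n n" by (simp add: B_def)
  have p_less: "p i < n" if "i < n" for i
    using permutes_in_image[OF p, of i] that by simp
  have "mat n n (\<lambda>(i, j). A $$ (p i, p j)) = (mat n n (\<lambda>(i, j). B\<^sup>T $$ (p i, j)))\<^sup>T"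
    by (rule eq_matI) (auto simp: B_def p_less)
  then have "det (mat n n (\<lambda>(i, j). A $$ (p i, p j))) = signof p * (signof p * det A)"
    using det_permute_rows[OF _ p, of "B\<^sup>T"] det_permute_rows[OF A p] det_transpose[OF B] B
      det_transpose[of "mat n n (\<lambda>(i, j). B\<^sup>T $$ (p i, j))" n]
    by (simp add: B_def)
  also have "\<dots> = det A"
    by (cases "evenperm p") (simp_all add: sign_def)
  finally show ?thesis .
qed

text \<open>Since \<open>p\<close> is injective, a simultaneous permutation sends diagonal entries
  to diagonal entries. It therefore commutes with passing to the characteristic matrix.\<close>

lemma char_poly_permute:
  assumes A: "A \<in> carrier_mat n n" and p: "p permutes {0..<n}"
  shows "char_poly (mat n n (\<lambda>(i, j). A $$ (p i, p j))) = char_poly A"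
proof -
  have p_less: "p i < n" if "i < n" for i
    using permutes_in_image[OF p, of i] that by simp
  have "char_poly_matrix (mat n n (\<lambda>(i, j). A $$ (p i, p j))) =
      mat n n (\<lambda>(i, j). char_poly_matrix A $$ (p i, p j))"
    using A by (intro eq_matI)
      (auto simp: char_poly_matrix_def p_less inj_eq[OF permutes_inj[OF p]])
  then show ?thesis
    unfolding char_poly_def using det_permute_both[OF char_poly_matrix_closed[OF A] p] by simp
qed

text \<open>Reduces an isomorphism of pair digraphs to its vertex map: the arc map must be
  \<open>map_prod f f\<close>. The bound on \<open>parcs H\<close> makes it surjective on arcs, as
  every arc of \<open>H\<close> then has endpoints in the image of \<open>f\<close>.\<close>

lemma digraph_iso_with_projI:
  assumes G: "pair_wf_digraph G"
    and f: "bij_betw f (pverts G) (pverts H)"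
    and arcs: "\<And>x y. x \<in> pverts G \<Longrightarrow> y \<in> pverts G \<Longrightarrow>
      (f x, f y) \<in> parcs H \<longleftrightarrow> (x, y) \<in> parcs G"
    and H: "parcs H \<subseteq> pverts H \<times> pverts H"
  shows "digraph_iso (with_proj G) (with_proj H)"
proof -
  interpret pair_wf_digraph G by (rule G)
  define h :: "('a, 'a \<times> 'a, 'b, 'b \<times> 'b) digraph_isomorphism" where
    "h = \<lparr>iso_verts = f, iso_arcs = map_prod f f, iso_head = snd, iso_tail = fst\<rparr>"
  have sub: "parcs G \<subseteq> pverts G \<times> pverts G"
    using in_arcsD1 in_arcsD2 by auto
  have inj: "inj_on f (pverts G)" and im: "f ` pverts G = pverts H"
    using f by (auto simp: bij_betw_def)
  have "inj_on (map_prod f f) (parcs G)"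
    using map_prod_inj_on[OF inj inj] sub by (rule inj_on_subset)
  then have "digraph_isomorphism h"
    using inj by (simp add: digraph_isomorphism_def h_def wf_digraph_wp_iff G)
  moreover have "parcs H = map_prod f f ` parcs G"
  proof
    show "parcs H \<subseteq> map_prod f f ` parcs G"
    proof
      fix e assume e: "e \<in> parcs H"
      then obtain x y where "e = (f x, f y)" "x \<in> pverts G" "y \<in> pverts G"
        using H im by (cases e) blast
      with e arcs show "e \<in> map_prod f f ` parcs G" by force
    qed
  qed (use sub arcs in force)
  then have "with_proj H = app_iso h (with_proj G)"
    by (simp add: with_proj_def app_iso_def h_def im)
  ultimately show ?thesis unfolding digraph_iso_def by blast
qed

text \<open>An isomorphism preserves tails and heads of arcs. When these are \<open>fst\<close> and
  \<open>snd\<close> on both sides, they are the two components of the image arc and determine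
  it.\<close>

lemma iso_arcs_eq_map_prod:
  assumes iso: "pre_digraph.digraph_isomorphism D h" "a \<in> arcs D"
    and D: "tail D = fst" "head D = snd" and h: "iso_tail h = fst" "iso_head h = snd"
  shows "iso_arcs h a = map_prod (iso_verts h) (iso_verts h) a"
  using iso D h unfolding pre_digraph.digraph_isomorphism_def
  by (metis (no_types, lifting) fst_map_prod prod_eqI snd_map_prod)

text \<open>An image arc could a priori come from a different arc of \<open>D\<close>. Injectivity
  of \<open>iso_verts h\<close> excludes this, but it is available only on \<open>verts D\<close>,
  hence the condition on \<open>x\<close> and \<open>y\<close>.\<close>

lemma arcs_app_iso_iff:
  assumes iso: "pre_digraph.digraph_isomorphism D h"
    and D: "tail D = fst" "head D = snd" and h: "iso_tail h = fst" "iso_head h = snd"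
    and xy: "x \<in> verts D" "y \<in> verts D"
  shows "(iso_verts h x, iso_verts h y) \<in> arcs (app_iso h D) \<longleftrightarrow> (x, y) \<in> arcs D"
proof -
  interpret wf_digraph D
    using iso by (simp add: pre_digraph.digraph_isomorphism_def)
  have "arcs (app_iso h D) = map_prod (iso_verts h) (iso_verts h) ` arcs D"
    using iso_arcs_eq_map_prod[OF iso _ D h] by (auto intro!: image_cong)
  moreover have "x = x' \<and> y = y'" if "(x', y') \<in> arcs D"
    "iso_verts h x = iso_verts h x'" "iso_verts h y = iso_verts h y'" for x' y'
  proof -
    have "x' \<in> verts D" "y' \<in> verts D"
      using tail_in_verts[OF that(1)] head_in_verts[OF that(1)] D by simp_all
    then show ?thesis
      using that(2,3) xy inj_onD[OF digraph_isomorphism_inj_on_verts[OF iso]] by metis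
  qed
  ultimately show ?thesis by force
qed

lemma digraph_iso_imp_cospectral:
  assumes "digraph_iso (with_proj G) (with_proj H)"
  shows "cospectral G H"
  unfolding cospectral_def
proof (intro allI impI, elim conjE)
  fix vs ws
  assume vs: "distinct vs" "set vs = pverts G" and ws: "distinct ws" "set ws = pverts H"
  obtain h where iso: "pre_digraph.digraph_isomorphism (with_proj G) h"
    and H: "with_proj H = app_iso h (with_proj G)"
    using assms unfolding digraph_iso_def by blast
  define f where "f = iso_verts h"
  have inj: "inj_on f (pverts G)"
    using iso by (simp add: pre_digraph.digraph_isomorphism_def f_def)
  have im: "pverts H = f ` pverts G" "parcs H = arcs (app_iso h (with_proj G))"
    "iso_tail h = fst" "iso_head h = snd"
    using H by (simp_all add: with_proj_def app_iso_def f_def)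
  have arcs: "(f x, f y) \<in> parcs H \<longleftrightarrow> (x, y) \<in> parcs G"
    if "x \<in> pverts G" "y \<in> pverts G" for x y
    using arcs_app_iso_iff[OF iso _ _ im(3,4), of x y] that by (simp add: im(2) f_def)
  \<comment> \<open>Both lists enumerate the vertices of \<open>H\<close> without repetition, so one
    is a permutation of the other. This \<open>p\<close> relates the two adjacency matrices.\<close>
  have "mset (map f vs) = mset ws"
    using vs ws inj im(1) by (intro set_eq_iff_mset_eq_distinct[THEN iffD1])
      (simp_all add: distinct_map)
  then obtain p where p: "p permutes {..<length ws}" and perm: "permute_list p ws = map f vs"
    by (rule mset_eq_permutation)
  have len: "length ws = length vs"
    using arg_cong[OF perm, of length] by simp
  have p': "p permutes {0..<length ws}"
    using p by (simp add: lessThan_atLeast0)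
  have nth: "ws ! p i = f (vs ! i)" "p i < length ws" if "i < length ws" for i
    using permute_list_nth[OF p that] permutes_in_image[OF p, of i] that len
    by (simp_all add: perm)
  have "adjacency_mat G vs =
      mat (length ws) (length ws) (\<lambda>(i, j). adjacency_mat H ws $$ (p i, p j))"
    using vs by (intro eq_matI) (auto simp: adjacency_mat_def len nth[unfolded len] arcs simp flip: vs(2))
  then have "char_poly (adjacency_mat G vs) = char_poly (adjacency_mat H ws)"
    using char_poly_permute[OF _ p', of "adjacency_mat H ws"] by (simp add: adjacency_mat_def)
  then show "proots (char_poly (adjacency_mat G vs)) = proots (char_poly (adjacency_mat H ws))"
    by simp
qed

text \<open>The hypothesis \<open>same\<close> is what the pseudo-bipartite and the bipartite case
  share, so one argument serves both.\<close>

lemma digraph_iso_gtpt: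
  assumes "clustered_graph G 2 m v"
    and same: "\<And>k l. k \<in> {1..m} \<Longrightarrow> l \<in> {1..m} \<Longrightarrow>
      (v 1 k, v 1 l) \<in> parcs G \<longleftrightarrow> (v 2 k, v 2 l) \<in> parcs G"
  shows "digraph_iso (with_proj G) (with_proj (gtpt G 2 m v))"
proof -
  interpret clustered_graph G 2 m v by fact
  let ?I = "{1..2} \<times> {1..m}" and ?v = "\<lambda>(i, k). v i k"
  \<comment> \<open>The inverse labelling reads off the indices of a vertex, and
    \<open>3 - i\<close> exchanges the clusters 1 and 2.\<close>
  define f where "f x = (case the_inv_into ?I ?v x of (i, k) \<Rightarrow> v (3 - i) k)" for x
  have f: "f (v i k) = v (3 - i) k" if "i \<in> {1..2}" "k \<in> {1..m}" for i k
    using the_inv_into_f_f[OF bij_betw_imp_inj_on[OF labelling], of "(i, k)"] that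
    by (simp add: f_def)
  have swap: "3 - i \<in> {1..2}" "3 - (3 - i) = i" if "i \<in> {1..2}" for i :: nat
    using that by auto
  have ff: "f x \<in> pverts G \<and> f (f x) = x" if "x \<in> pverts G" for x
    using that by (elim vertex_cases) (metis f swap label_in_verts)
  \<comment> \<open>The swap is an involution, hence its own inverse.\<close>
  have "bij_betw f (pverts G) (pverts G)"
    by (rule bij_betw_byWitness[where f' = f]) (use ff in auto)
  moreover have "(f x, f y) \<in> parcs (gtpt G 2 m v) \<longleftrightarrow> (x, y) \<in> parcs G"
    if "x \<in> pverts G" "y \<in> pverts G" for x y
  proof -
    obtain i k where x: "x = v i k" and ik: "i \<in> {1..2}" "k \<in> {1..m}"
      using \<open>x \<in> pverts G\<close> by (rule vertex_cases)
    obtain j l where y: "y = v j l" and jl: "j \<in> {1..2}" "l \<in> {1..m}"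
      using \<open>y \<in> pverts G\<close> by (rule vertex_cases)
    have "(f x, f y) \<in> parcs (gtpt G 2 m v) \<longleftrightarrow> (v (3 - i) l, v (3 - j) k) \<in> parcs G"
      using x y ik jl by (simp only: f gtpt_arc_iff swap)
    \<comment> \<open>If \<open>i\<close> and \<open>j\<close> differ, then \<open>3 - i = j\<close>
      and \<open>3 - j = i\<close>, and both sides are the same arc. If they agree,
      \<open>same\<close> moves the arc to the other cluster.\<close>
    also have "\<dots> \<longleftrightarrow> (v j l, v i k) \<in> parcs G"
    proof -
      have "i = 1 \<or> i = 2" "j = 1 \<or> j = 2" using ik jl by auto
      then show ?thesis
        using same[of k l] same[of l k] arc_sym ik jl by (auto simp: numeral_2_eq_2)
    qed
    also have "\<dots> \<longleftrightarrow> (x, y) \<in> parcs G"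
      using x y arc_sym by blast
    finally show ?thesis .
  qed
  moreover have "parcs (gtpt G 2 m v) \<subseteq> pverts G \<times> pverts G"
    using gtpt_arcs_in_verts by auto
  moreover have "pverts (gtpt G 2 m v) = pverts G"
    by (simp add: gtpt_def)
  moreover have "pair_wf_digraph G" ..
  ultimately show ?thesis
    by (intro digraph_iso_with_projI[where f = f]) simp_all
qed

lemma pseudo_bipartite_arc_iff:
  assumes "pseudo_bipartite G m v" and kl: "k \<in> {1..m}" "l \<in> {1..m}"
  shows "(v 1 k, v 1 l) \<in> parcs G \<longleftrightarrow> (v 2 k, v 2 l) \<in> parcs G"
proof -
  let ?D = "\<lambda>i. with_proj G \<restriction> cluster m v i"
  obtain h where iso: "pre_digraph.digraph_isomorphism (?D 1) h"
    and h: "\<forall>k \<in> {1..m}. iso_verts h (v 1 k) = v 2 k" and app: "?D 2 = app_iso h (?D 1)"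
    using assms(1) unfolding pseudo_bipartite_def by blast
  have mem: "v i k \<in> cluster m v i" "v i l \<in> cluster m v i" for i
    using kl by (simp_all add: cluster_def)
  \<comment> \<open>Equal digraphs have equal tail and head functions, and those of the second
    cluster are the projections.\<close>
  have "iso_tail h = fst" "iso_head h = snd"
    using arg_cong[OF app, of tail] arg_cong[OF app, of head] by simp_all
  then have "(iso_verts h (v 1 k), iso_verts h (v 1 l)) \<in> arcs (app_iso h (?D 1)) \<longleftrightarrow>
      (v 1 k, v 1 l) \<in> arcs (?D 1)"
    using mem by (intro arcs_app_iso_iff[OF iso]) simp_all
  then have "(v 2 k, v 2 l) \<in> arcs (?D 2) \<longleftrightarrow> (v 1 k, v 1 l) \<in> arcs (?D 1)"
    unfolding app using h kl by simp
  then show ?thesis using mem by simp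
qed

theorem theorem2:
  fixes G :: "'a pair_pre_digraph" and m :: nat and v :: "nat \<Rightarrow> nat \<Rightarrow> 'a"
  assumes "clustered_graph G 2 m v"
  shows "(pseudo_bipartite G m v \<longrightarrow>
            digraph_iso (with_proj G) (with_proj (gtpt G 2 m v)) \<and>
            cospectral G (gtpt G 2 m v)) \<and>
         (bipartition G (cluster m v 1) (cluster m v 2) \<longrightarrow>
            digraph_iso (with_proj G) (with_proj (gtpt G 2 m v)))"
proof (intro conjI impI)
  assume "pseudo_bipartite G m v"
  then show iso: "digraph_iso (with_proj G) (with_proj (gtpt G 2 m v))"
    by (intro digraph_iso_gtpt[OF assms] pseudo_bipartite_arc_iff)
  then show "cospectral G (gtpt G 2 m v)"
    by (rule digraph_iso_imp_cospectral)
next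
  assume bip: "bipartition G (cluster m v 1) (cluster m v 2)"
  show "digraph_iso (with_proj G) (with_proj (gtpt G 2 m v))"
  proof (rule digraph_iso_gtpt[OF assms])
    fix k l assume "k \<in> {1..m}" "l \<in> {1..m}"
    then have "v i k \<in> cluster m v i" "v i l \<in> cluster m v i" for i
      by (simp_all add: cluster_def)
    \<comment> \<open>An arc joins opposite parts and the parts are disjoint, so both clusters are
      edgeless.\<close>
    then have "(v 1 k, v 1 l) \<notin> parcs G" "(v 2 k, v 2 l) \<notin> parcs G"
      using bip unfolding bipartition_def by blast+
    then show "(v 1 k, v 1 l) \<in> parcs G \<longleftrightarrow> (v 2 k, v 2 l) \<in> parcs G" by simp
  qed
qed

end
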